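(* Let $(x_n)_{n=1}^{\infty}$ be a sequence on $\mathbb{T}=\mathbb{R}/\mathbb{Z}$. If there exists a sequence $(t_n)_{n=1}^{\infty}$ of positive and bounded real numbers such that $$ \lim_{N \rightarrow \infty} \frac{1}{N^2} \sum_{m,n = 1}^{N} \theta_{t_N}(x_n - x_m) = 1,$$ then $(x_n)_{n=1}^{\infty}$ is uniformly distributed on $\mathbb{T}$.
   Context: $\mathbb{T}$ is the one-dimensional torus normalized to have length $1$. For $t>0$, the Jacobi $\theta$-function is $\theta_t(x) = 1 + 2 \sum_{n=1}^{\infty} e^{-4 \pi^2 n^2 t}\cos(2 \pi n x)$. A sequence on $\mathbb{T}$ is uniformly distributed if for every interval (arc) $J\subset\mathbb{T}$, $\lim_{N\to\infty}\frac1N\#\{1\le i\le N: x_i\in J\}=|J|$, where $|J|$ is the length of $J$. *)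

theory Defs
  imports "HOL-Analysis.Analysis"
begin

definition int_cong :: "real \<Rightarrow> real \<Rightarrow> bool" where
  "int_cong x y \<longleftrightarrow> x - y \<in> \<int>"

lemma equivp_int_cong: "equivp int_cong"
proof (rule equivpI)
  show "reflp int_cong"
    by (auto simp: reflp_def int_cong_def)
  show "symp int_cong"
    unfolding symp_def int_cong_def by (metis Ints_minus minus_diff_eq)
  show "transp int_cong"
    unfolding transp_def int_cong_def
    by (metis Ints_add add_diff_eq diff_add_cancel)
qed

quotient_type torus = real / int_cong
  by (rule equivp_int_cong)

lift_definition torus_of :: "real \<Rightarrow> torus" is "\<lambda>x. x" .

instantiation torus :: ab_group_add
begin

lift_definition zero_torus :: torus is 0 .

lift_definition plus_torus :: "torus \<Rightarrow> torus \<Rightarrow> torus" is "(+)"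
  unfolding int_cong_def by (metis Ints_add add_diff_add)

lift_definition minus_torus :: "torus \<Rightarrow> torus \<Rightarrow> torus" is "(-)"
  unfolding int_cong_def by (metis Ints_diff diff_diff_eq2 diff_add_eq add_diff_eq diff_right_commute)

lift_definition uminus_torus :: "torus \<Rightarrow> torus" is uminus
  unfolding int_cong_def by (metis Ints_minus minus_diff_minus)

instance
  by standard (transfer; simp add: int_cong_def algebra_simps)+

end

definition theta_real :: "real \<Rightarrow> real \<Rightarrow> real" where
  "theta_real t x =
     1 + 2 * (\<Sum>k. let n = real (Suc k) in exp (- 4 * pi\<^sup>2 * n\<^sup>2 * t) * cos (2 * pi * n * x))"

lemma cos_int_cong:
  assumes "int_cong x y"
  shows "cos (2 * pi * real n * x) = cos (2 * pi * real n * y)"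
proof -
  from assms obtain m :: int where "x = y + of_int m"
    unfolding int_cong_def by (metis Ints_cases add.commute diff_add_cancel)
  then have "2 * pi * real n * x = 2 * pi * real n * y + of_int (int n * m) * (2 * pi)"
    by (simp add: algebra_simps)
  then show ?thesis
    by (simp add: cos_add mult.commute[of _ "2 * pi"] del: of_int_mult)
qed

lift_definition theta :: "real \<Rightarrow> torus \<Rightarrow> real" is theta_real
  unfolding theta_real_def Let_def by (simp only: cos_int_cong)

text \<open>
  An arc is the injective image of an interval of reals, and its length is the length of that
  interval. The condition of injectivity excludes intervals that overlap themselves on the torus;
  open, closed and half-open arcs, degenerate arcs and the whole torus (the image of \<open>[0, 1)\<close>) are
  all covered. Sequences are indexed from 1, so the value at index 0 is never used.
\<close>

definition uniformly_distributed :: "(nat \<Rightarrow> torus) \<Rightarrow> bool" where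
  "uniformly_distributed x \<longleftrightarrow>
     (\<forall>I :: real set. is_interval I \<and> inj_on torus_of I \<longrightarrow>
        (\<lambda>N. real (card {i \<in> {1..N}. x i \<in> torus_of ` I}) / real N)
          \<longlonglongrightarrow> measure lborel I)"

end

theory Submission
  imports Defs
begin

text \<open>
  Expanding \<open>\<theta>\<^sub>t\<close> in its Fourier series turns the double sum into
  \<open>N\<^sup>2 + 2 \<Sum>\<^sub>k exp(-4\<pi>\<^sup>2k\<^sup>2t) |S\<^sub>k(N)|\<^sup>2\<close>, where \<open>S\<^sub>k(N)\<close> is the \<open>k\<close>-th
  Weyl sum. All terms are nonnegative and \<open>t\<^sub>N\<close> is bounded, so the hypothesis forces
  \<open>S\<^sub>k(N) / N \<rightarrow> 0\<close> for every \<open>k \<ge> 1\<close>, and Weyl's criterion applies. For the latter,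
  Stone--Weierstrass extends the convergence of averages from trigonometric polynomials to
  continuous functions on the circle, and tent functions bound the frequency of a closed arc
  from above. Applied to the closures of an arc and of its complement, whose lengths add up to
  one, these upper bounds pin down the limit.
\<close>

section \<open>Points of the torus as points of the unit circle\<close>

text \<open>Identifies the torus with the unit circle in the complex plane, where both distances to
  an arc and polynomial approximation are available.\<close>

lemma torus_of_eq_iff: "torus_of s = torus_of u \<longleftrightarrow> cis (2 * pi * s) = cis (2 * pi * u)"
proof -
  have "cis (2 * pi * s) = cis (2 * pi * u) \<longleftrightarrow> (\<exists>n::int. 2 * pi * s = 2 * pi * u + 2 * pi * n)"
    by (auto simp: complex_eq_iff sin_cos_eq_iff [symmetric])
  also have "\<dots> \<longleftrightarrow> (\<exists>n::int. s = u + n)"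
  proof -
    have "2 * pi * s = 2 * pi * u + 2 * pi * n \<longleftrightarrow> s = u + n" for n :: int
      by (metis distrib_left mult_cancel_left mult_eq_0_iff pi_neq_zero zero_neq_numeral)
    then show ?thesis by simp
  qed
  also have "\<dots> \<longleftrightarrow> s - u \<in> \<int>"
    by (metis Ints_cases Ints_of_int add_diff_cancel_left' diff_add_cancel add.commute)
  also have "\<dots> \<longleftrightarrow> torus_of s = torus_of u"
    by transfer (simp add: int_cong_def)
  finally show ?thesis by simp
qed

lemma surj_torus_of: "surj torus_of"
  unfolding surj_def by transfer (auto intro: equivp_reflp [OF equivp_int_cong])

lemma theta_torus_of: "theta t (torus_of s - torus_of u) = theta_real t (s - u)"
  by transfer simp

section \<open>From the theta hypothesis to vanishing Weyl sums\<close>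

text \<open>The addition formula splits the double sum into the squares of the sum of cosines and of
  the sum of sines, which are the real and imaginary parts on the right.\<close>

lemma sum_cos_diff:
  fixes \<phi> :: "'a \<Rightarrow> real"
  shows "(\<Sum>m\<in>A. \<Sum>n\<in>A. cos (\<phi> n - \<phi> m)) = (norm (\<Sum>n\<in>A. cis (\<phi> n)))\<^sup>2"
  unfolding cmod_power2 by (simp add: cos_diff sum.distrib sum_product power2_eq_square mult.commute)

lemma summable_theta:
  assumes "t > 0"
  shows "summable (\<lambda>k. let n = real (Suc k) in exp (- 4 * pi\<^sup>2 * n\<^sup>2 * t) * cos (2 * pi * n * x))"
proof (rule summable_comparison_test')
  let ?q = "exp (- 4 * pi\<^sup>2 * t)"
  show "summable (\<lambda>k. ?q ^ k)"
    using assms by (intro summable_geometric) simp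
  show "norm (let n = real (Suc k) in exp (- 4 * pi\<^sup>2 * n\<^sup>2 * t) * cos (2 * pi * n * x)) \<le> ?q ^ k"
    if "k \<ge> 0" for k
  proof -
    \<comment> \<open>This crude bound on the Gaussian exponent suffices for comparison with a
      geometric series.\<close>
    have "real k \<le> (real (Suc k))\<^sup>2"
      by (simp add: power2_eq_square algebra_simps)
    then have "(4 * pi\<^sup>2 * t) * real k \<le> (4 * pi\<^sup>2 * t) * (real (Suc k))\<^sup>2"
      using assms by (intro mult_left_mono) auto
    then have "exp (- 4 * pi\<^sup>2 * (real (Suc k))\<^sup>2 * t) \<le> ?q ^ k"
      by (simp add: exp_of_nat_mult [symmetric] algebra_simps del: of_nat_Suc)
    moreover have "\<bar>cos (2 * pi * real (Suc k) * x)\<bar> \<le> 1"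
      by simp
    ultimately have "exp (- 4 * pi\<^sup>2 * (real (Suc k))\<^sup>2 * t) * \<bar>cos (2 * pi * real (Suc k) * x)\<bar> \<le> ?q ^ k * 1"
      by (intro mult_mono) auto
    then show ?thesis
      by (simp add: Let_def abs_mult del: of_nat_Suc)
  qed
qed

text \<open>The constant term of theta contributes \<open>N\<close> squared, and every frequency
  contributes a nonnegative amount by \<open>sum_cos_diff\<close>. Discarding all frequencies except
  \<open>Suc k\<close> leaves the left side.\<close>

lemma theta_sum_lower_bound:
  fixes r :: "nat \<Rightarrow> real"
  assumes "t > 0"
  shows "(real N)\<^sup>2 + 2 * exp (- 4 * pi\<^sup>2 * (real (Suc k))\<^sup>2 * t) *
            (norm (\<Sum>n=1..N. cis (2 * pi * real (Suc k) * r n)))\<^sup>2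
         \<le> (\<Sum>m=1..N. \<Sum>n=1..N. theta_real t (r n - r m))"
proof -
  let ?f = "\<lambda>k y. let n = real (Suc k) in exp (- 4 * pi\<^sup>2 * n\<^sup>2 * t) * cos (2 * pi * n * y)"
  let ?g = "\<lambda>k. exp (- 4 * pi\<^sup>2 * (real (Suc k))\<^sup>2 * t) *
            (norm (\<Sum>n=1..N. cis (2 * pi * real (Suc k) * r n)))\<^sup>2"
  have fg: "(\<Sum>m=1..N. \<Sum>n=1..N. ?f k (r n - r m)) = ?g k" for k
    using sum_cos_diff [of "\<lambda>n. 2 * pi * real (Suc k) * r n" "{1..N}"]
    by (simp add: Let_def sum_distrib_left [symmetric] right_diff_distrib del: of_nat_Suc)
  have sm: "summable (\<lambda>k. \<Sum>m=1..N. \<Sum>n=1..N. ?f k (r n - r m))"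
    by (intro summable_sum summable_theta assms)
  have "?g k \<le> (\<Sum>k. ?g k)"
    using sum_le_suminf [of ?g "{k}"] sm unfolding fg by simp
  \<comment> \<open>Series and finite sums may be exchanged because the series converges for each
    pair of points.\<close>
  also have "\<dots> = (\<Sum>m=1..N. \<Sum>n=1..N. \<Sum>k. ?f k (r n - r m))"
    unfolding fg [symmetric]
    by (subst suminf_sum, intro summable_sum summable_theta assms)
       (intro sum.cong refl suminf_sum summable_theta assms)
  finally have "(real N)\<^sup>2 + 2 * ?g k \<le> (real N)\<^sup>2 + 2 * \<dots>"
    by linarith
  then show ?thesis
    by (simp add: theta_real_def sum.distrib sum_distrib_left power2_eq_square mult.assoc del: of_nat_Suc)
qed

text \<open>An upper bound on the times keeps the Gaussian weight of a fixed frequency away from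
  zero, so the excess of the normalized theta sum over 1 controls that Weyl sum.\<close>

lemma weyl_sums_tendsto_0:
  fixes r t :: "nat \<Rightarrow> real"
  assumes pos: "\<And>n. n \<ge> 1 \<Longrightarrow> t n > 0" and bdd: "bounded (t ` {1..})"
    and lim: "(\<lambda>N. (\<Sum>m=1..N. \<Sum>n=1..N. theta_real (t N) (r n - r m)) / (real N)\<^sup>2) \<longlonglongrightarrow> 1"
  shows "(\<lambda>N. (\<Sum>n=1..N. cis (2 * pi * real (Suc k) * r n)) / of_nat N) \<longlonglongrightarrow> 0"
proof -
  obtain B where B: "\<And>n. n \<ge> 1 \<Longrightarrow> t n \<le> B"
    using bdd unfolding bounded_real by (metis abs_le_D1 atLeast_iff imageI)
  \<comment> \<open>\<open>1 / E\<close> is the value of the Gaussian weight at time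
    \<open>B\<close>, hence a lower bound for it at every \<open>t N\<close> with \<open>N\<close>
    at least 1.\<close>
  define E where "E = exp (4 * pi\<^sup>2 * (real (Suc k))\<^sup>2 * B)"
  have half: "y \<le> (A - 1) / 2" if "q \<le> A" "q = 1 + 2 * y" for q A y :: real
    using that by simp
  let ?A = "\<lambda>N. (\<Sum>m=1..N. \<Sum>n=1..N. theta_real (t N) (r n - r m)) / (real N)\<^sup>2"
  let ?S = "\<lambda>N. (\<Sum>n=1..N. cis (2 * pi * real (Suc k) * r n))"
  have "(\<lambda>N. (norm (?S N / of_nat N))\<^sup>2) \<longlonglongrightarrow> 0"
  proof (rule tendsto_sandwich [OF _ _ tendsto_const])
    have "(\<lambda>N. E * ((?A N - 1) / 2)) \<longlonglongrightarrow> E * ((1 - 1) / 2)"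
      by (intro tendsto_intros lim) simp
    then show "(\<lambda>N. E * ((?A N - 1) / 2)) \<longlonglongrightarrow> 0"
      by simp
    show "\<forall>\<^sub>F N in sequentially. (norm (?S N / of_nat N))\<^sup>2 \<le> E * ((?A N - 1) / 2)"
      using eventually_ge_at_top [of 1]
    proof eventually_elim
      case (elim N)
      let ?c = "exp (- 4 * pi\<^sup>2 * (real (Suc k))\<^sup>2 * t N)"
      have "4 * pi\<^sup>2 * (real (Suc k))\<^sup>2 * t N \<le> 4 * pi\<^sup>2 * (real (Suc k))\<^sup>2 * B"
        using B [OF elim] by (intro mult_left_mono) auto
      then have Ec: "1 \<le> E * ?c"
        by (simp add: E_def exp_add [symmetric] del: of_nat_Suc)
      have "((real N)\<^sup>2 + 2 * ?c * (norm (?S N))\<^sup>2) / (real N)\<^sup>2 \<le> ?A N"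
        by (intro divide_right_mono theta_sum_lower_bound pos elim) auto
      moreover have "((real N)\<^sup>2 + 2 * ?c * (norm (?S N))\<^sup>2) / (real N)\<^sup>2
          = 1 + 2 * (?c * (norm (?S N / of_nat N))\<^sup>2)"
        using elim by (simp add: norm_divide power_divide add_divide_distrib del: of_nat_Suc)
      ultimately have "?c * (norm (?S N / of_nat N))\<^sup>2 \<le> (?A N - 1) / 2"
        by (rule half)
      then have "E * (?c * (norm (?S N / of_nat N))\<^sup>2) \<le> E * ((?A N - 1) / 2)"
        by (intro mult_left_mono) (auto simp: E_def)
      moreover have "1 * (norm (?S N / of_nat N))\<^sup>2 \<le> (E * ?c) * (norm (?S N / of_nat N))\<^sup>2"
        by (intro mult_right_mono Ec) auto
      ultimately show ?case
        by (simp only: mult_1 mult.assoc)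
    qed
  qed auto
  then have "(\<lambda>N. norm (?S N / of_nat N)) \<longlonglongrightarrow> 0"
    using tendsto_real_sqrt by fastforce
  then show ?thesis
    by (rule tendsto_norm_zero_cancel)
qed

section \<open>Trigonometric polynomials and continuous functions\<close>

text \<open>The complex span of the characters, as functions of a real parameter. The inductive form
  reduces linear statements to a single character; frequencies may be zero or negative.\<close>

inductive trig_poly :: "(real \<Rightarrow> complex) \<Rightarrow> bool" where
  monom: "trig_poly (\<lambda>s. cis (2 * pi * of_int k * s))"
| scale: "trig_poly f \<Longrightarrow> trig_poly (\<lambda>s. c * f s)"
| add: "trig_poly f \<Longrightarrow> trig_poly g \<Longrightarrow> trig_poly (\<lambda>s. f s + g s)"

lemma trig_poly_mult_monom:
  assumes "trig_poly f"
  shows "trig_poly (\<lambda>s. cis (2 * pi * of_int j * s) * f s)"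
  using assms
proof induction
  case (monom k)
  show ?case
    using trig_poly.monom [of "j + k"] by (simp add: cis_mult algebra_simps)
next
  case (scale f c)
  show ?case
    using trig_poly.scale [OF scale.IH, of c] by (simp add: mult.left_commute)
next
  case (add f g)
  show ?case
    using trig_poly.add [OF add.IH] by (simp add: distrib_left)
qed

text \<open>
  The factor \<open>f\<close> makes the induction go through products of polynomials without showing that
  trigonometric polynomials are closed under multiplication.
\<close>

lemma trig_poly_real_polynomial:
  assumes "real_polynomial_function p" "trig_poly f"
  shows "trig_poly (\<lambda>s. complex_of_real (p (cis (2 * pi * s))) * f s)"
  using assms
proof (induction arbitrary: f)
  case (linear p)
  interpret bounded_linear p by fact
  \<comment> \<open>A real-linear functional on the complex plane is determined by its values at
    \<open>1\<close> and \<open>\<i>\<close>.\<close>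
  have p: "p z = Re z * p 1 + Im z * p \<i>" for z
  proof -
    have "p z = p (Re z *\<^sub>R 1 + Im z *\<^sub>R \<i>)"
      by (metis complex_eq mult.commute scaleR_conv_of_real mult.right_neutral)
    then show ?thesis by (simp add: add scaleR)
  qed
  \<comment> \<open>Euler's formulas for cosine and sine, collected by the frequencies 1 and
    -1.\<close>
  have eq: "complex_of_real (p (cis \<phi>)) =
      ((p 1 - \<i> * p \<i>) / 2) * cis \<phi> + ((p 1 + \<i> * p \<i>) / 2) * cis (- \<phi>)" for \<phi>
    by (subst p) (simp add: complex_eq_iff field_simps)
  have "trig_poly (\<lambda>s. ((p 1 - \<i> * p \<i>) / 2) * (cis (2 * pi * of_int 1 * s) * f s)
      + ((p 1 + \<i> * p \<i>) / 2) * (cis (2 * pi * of_int (-1) * s) * f s))"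
    by (intro trig_poly.intros trig_poly_mult_monom linear.prems)
  then show ?case
    by (simp add: eq distrib_right mult.assoc)
next
  case (const c)
  then show ?case by (rule trig_poly.scale)
next
  case (add p q)
  then show ?case by (simp add: distrib_right trig_poly.add)
next
  case (mult p q)
  then show ?case by (simp add: mult.assoc)
qed

text \<open>A nontrivial character has a periodic antiderivative. The period starts at an arbitrary
  \<open>a\<close>, so that it can later begin at the left end of an arc.\<close>

lemma has_integral_cis_period:
  "((\<lambda>s. cis (2 * pi * of_int k * s)) has_integral (if k = 0 then 1 else 0)) {a..a + 1}"
proof (cases "k = 0")
  case True
  then show ?thesis
    using has_integral_const_real [of "1::complex" a "a + 1"] by simp
next
  case False
  let ?c = "2 * pi * of_int k"
  let ?F = "\<lambda>s. cis (?c * s) / (\<i> * of_real ?c)"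
  have "((\<lambda>s. cis (?c * s)) has_integral ?F (a + 1) - ?F a) {a..a + 1}"
  proof (rule fundamental_theorem_of_calculus)
    show "(?F has_vector_derivative cis (?c * s)) (at s within {a..a + 1})" for s
      unfolding cis_conv_exp using False
      by (auto intro!: derivative_eq_intros has_vector_derivative_real_field simp: field_simps)
  qed simp
  moreover have "cis (?c * (a + 1)) = cis (?c * a)"
    by (simp add: distrib_left cis_mult [symmetric] cis_multiple_2pi)
  ultimately show ?thesis
    using False by simp
qed

text \<open>Negative frequencies follow from positive ones by complex conjugation.\<close>

lemma weyl_sums_int_tendsto_0:
  fixes r :: "nat \<Rightarrow> real"
  assumes weyl: "\<And>k. (\<lambda>N. (\<Sum>n=1..N. cis (2 * pi * real (Suc k) * r n)) / of_nat N) \<longlonglongrightarrow> 0"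
    and "j \<noteq> 0"
  shows "(\<lambda>N. (\<Sum>n=1..N. cis (2 * pi * of_int j * r n)) / of_nat N) \<longlonglongrightarrow> 0"
proof -
  obtain k where k: "nat \<bar>j\<bar> = Suc k"
    using \<open>j \<noteq> 0\<close> by (metis abs_eq_0 nat_0_iff not0_implies_Suc abs_ge_zero antisym)
  show ?thesis
  proof (cases "j > 0")
    case True
    then have "real_of_int j = real (Suc k)" using k by linarith
    then show ?thesis using weyl [of k] by simp
  next
    case False
    then have j: "real_of_int j = - real (Suc k)" using k \<open>j \<noteq> 0\<close> by linarith
    have "(\<lambda>N. cnj ((\<Sum>n=1..N. cis (2 * pi * real (Suc k) * r n)) / of_nat N)) \<longlonglongrightarrow> cnj 0"
      by (intro tendsto_cnj weyl)
    then show ?thesis by (simp add: j cis_cnj del: of_nat_Suc)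
  qed
qed

text \<open>Integral and limit of averages are both linear in \<open>f\<close>, so characters
  decide. Carrying one common value \<open>c\<close> through the induction shows that the two agree
  without computing it.\<close>

lemma weyl_trig_poly:
  fixes r :: "nat \<Rightarrow> real"
  assumes weyl: "\<And>k. (\<lambda>N. (\<Sum>n=1..N. cis (2 * pi * real (Suc k) * r n)) / of_nat N) \<longlonglongrightarrow> 0"
    and "trig_poly f"
  shows "\<exists>c. (f has_integral c) {a..a + 1} \<and> (\<lambda>N. (\<Sum>n=1..N. f (r n)) / of_nat N) \<longlonglongrightarrow> c"
  using \<open>trig_poly f\<close>
proof induction
  case (monom k)
  have "(\<lambda>N. (\<Sum>n=1..N. cis (2 * pi * of_int k * r n)) / of_nat N) \<longlonglongrightarrow> (if k = 0 then 1 else 0)"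
  proof (cases "k = 0")
    case True
    \<comment> \<open>Only eventually: at \<open>N = 0\<close> the quotient is 0 by the convention
      for division by zero.\<close>
    have "\<forall>\<^sub>F N in sequentially. (\<Sum>n=1..N. cis (2 * pi * of_int k * r n)) / of_nat N = 1"
      using eventually_gt_at_top [of 0] by eventually_elim (simp add: True)
    then show ?thesis using True by (simp add: tendsto_eventually)
  next
    case False
    then show ?thesis using weyl_sums_int_tendsto_0 [OF weyl] by simp
  qed
  then show ?case
    using has_integral_cis_period by blast
next
  case (scale f c)
  then obtain d where "(f has_integral d) {a..a + 1}" "(\<lambda>N. (\<Sum>n=1..N. f (r n)) / of_nat N) \<longlonglongrightarrow> d"
    by blast
  then show ?case
    by (intro exI [of _ "c * d"] conjI has_integral_mult_right)
       (auto dest: tendsto_mult_left [of _ _ _ c] simp: sum_distrib_left)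
next
  case (add f g)
  then obtain c d where "(f has_integral c) {a..a + 1}" "(\<lambda>N. (\<Sum>n=1..N. f (r n)) / of_nat N) \<longlonglongrightarrow> c"
    "(g has_integral d) {a..a + 1}" "(\<lambda>N. (\<Sum>n=1..N. g (r n)) / of_nat N) \<longlonglongrightarrow> d"
    by blast
  then show ?case
    by (intro exI [of _ "c + d"] conjI has_integral_add)
       (auto dest: tendsto_add simp: sum.distrib add_divide_distrib)
qed

text \<open>A three-epsilon argument: a polynomial \<open>p\<close> uniformly within
  \<open>e / 3\<close> of \<open>F\<close> on the circle changes both the averages and the integral
  by at most \<open>e / 3\<close>.\<close>

lemma weyl_continuous:
  fixes r :: "nat \<Rightarrow> real" and F :: "complex \<Rightarrow> real"
  assumes weyl: "\<And>k. (\<lambda>N. (\<Sum>n=1..N. cis (2 * pi * real (Suc k) * r n)) / of_nat N) \<longlonglongrightarrow> 0"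
    and F: "continuous_on (sphere 0 1) F"
  shows "(\<lambda>N. (\<Sum>n=1..N. F (cis (2 * pi * r n))) / real N)
           \<longlonglongrightarrow> integral {a..a + 1} (\<lambda>s. F (cis (2 * pi * s)))"
proof (rule LIMSEQ_I)
  fix e :: real assume "e > 0"
  let ?I = "integral {a..a + 1} (\<lambda>s. F (cis (2 * pi * s)))"
  obtain p where p: "real_polynomial_function p" and
    Fp: "\<And>z. z \<in> sphere 0 1 \<Longrightarrow> \<bar>F z - p z\<bar> < e / 3"
    using Stone_Weierstrass_real_polynomial_function [OF compact_sphere F, of "e / 3"] \<open>e > 0\<close>
    by auto
  have Fp': "\<bar>F (cis u) - p (cis u)\<bar> \<le> e / 3" for u
    using Fp [of "cis u"] by (simp add: less_imp_le)
  have "trig_poly (\<lambda>s. 1)"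
    using trig_poly.monom [of 0] by simp
  then have "trig_poly (\<lambda>s. complex_of_real (p (cis (2 * pi * s))))"
    using trig_poly_real_polynomial [OF p] by fastforce
  then obtain c where
    c: "((\<lambda>s. complex_of_real (p (cis (2 * pi * s)))) has_integral c) {a..a + 1}" and
    lim: "(\<lambda>N. (\<Sum>n=1..N. complex_of_real (p (cis (2 * pi * r n)))) / of_nat N) \<longlonglongrightarrow> c"
    using weyl_trig_poly [OF weyl] by blast
  have c': "((\<lambda>s. p (cis (2 * pi * s))) has_integral Re c) {a..a + 1}"
    using has_integral_Re [OF c] by simp
  have lim': "(\<lambda>N. (\<Sum>n=1..N. p (cis (2 * pi * r n))) / real N) \<longlonglongrightarrow> Re c"
    using tendsto_Re [OF lim] by simp
  have "(\<lambda>s. F (cis (2 * pi * s))) integrable_on {a..a + 1}"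
    by (intro integrable_continuous_real continuous_on_compose2 [OF F] continuous_intros) auto
  then have "((\<lambda>s. F (cis (2 * pi * s)) - p (cis (2 * pi * s))) has_integral ?I - Re c) {a..a + 1}"
    using c' by (intro has_integral_diff integrable_integral)
  \<comment> \<open>The period has length one, so the uniform bound passes to the integral
    unchanged.\<close>
  then have Ic: "\<bar>?I - Re c\<bar> \<le> e / 3"
    using has_integral_bound_real [OF _ finite.emptyI, of "e / 3" _ "?I - Re c" a "a + 1"] Fp' \<open>e > 0\<close>
    by (simp only: real_norm_def) simp
  obtain N0 where N0: "\<And>N. N \<ge> N0 \<Longrightarrow> \<bar>(\<Sum>n=1..N. p (cis (2 * pi * r n))) / real N - Re c\<bar> < e / 3"
    using LIMSEQ_D [OF lim', of "e / 3"] \<open>e > 0\<close> by auto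
  show "\<exists>N0. \<forall>N\<ge>N0. norm ((\<Sum>n=1..N. F (cis (2 * pi * r n))) / real N - ?I) < e"
  proof (intro exI allI impI)
    fix N assume N: "N \<ge> max N0 1"
    have "\<bar>(\<Sum>n=1..N. F (cis (2 * pi * r n))) - (\<Sum>n=1..N. p (cis (2 * pi * r n)))\<bar>
        \<le> (\<Sum>n=1..N. \<bar>F (cis (2 * pi * r n)) - p (cis (2 * pi * r n))\<bar>)"
      unfolding sum_subtractf [symmetric] by (rule sum_abs)
    also have "\<dots> \<le> real N * (e / 3)"
      using sum_bounded_above [of "{1..N}" "\<lambda>n. \<bar>F (cis (2 * pi * r n)) - p (cis (2 * pi * r n))\<bar>" "e / 3"] Fp'
      by simp
    finally have "\<bar>(\<Sum>n=1..N. F (cis (2 * pi * r n))) - (\<Sum>n=1..N. p (cis (2 * pi * r n)))\<bar> / real N \<le> e / 3"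
      using N by (simp add: divide_le_eq mult.commute)
    then have "\<bar>(\<Sum>n=1..N. F (cis (2 * pi * r n))) / real N - (\<Sum>n=1..N. p (cis (2 * pi * r n))) / real N\<bar> \<le> e / 3"
      by (simp add: diff_divide_distrib [symmetric])
    moreover have "N \<ge> N0" using N by simp
    ultimately show "norm ((\<Sum>n=1..N. F (cis (2 * pi * r n))) / real N - ?I) < e"
      using N0 [of N] Ic unfolding real_norm_def by linarith
  qed
qed

section \<open>Upper bounds for closed arcs\<close>

text \<open>Since \<open>K\<close> is closed, a point outside it has positive distance from it, so
  the tents converge pointwise to the indicator of \<open>K\<close>; dominated convergence with
  bound 1 finishes.\<close>

lemma integral_tent_tendsto:
  fixes a b :: real
  assumes "a \<le> b" "b \<le> a + 1"
  defines "K \<equiv> (\<lambda>s. cis (2 * pi * s)) ` {a..b}"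
  shows "(\<lambda>j. integral {a..a + 1} (\<lambda>s. max 0 (1 - real j * infdist (cis (2 * pi * s)) K))) \<longlonglongrightarrow> b - a"
proof -
  let ?e = "\<lambda>s. cis (2 * pi * s)"
  let ?\<chi> = "\<lambda>s. if ?e s \<in> K then 1 else 0 :: real"
  have "compact K"
    unfolding K_def by (intro compact_continuous_image continuous_intros) auto
  then have "closed K" "K \<noteq> {}"
    using assms(1) by (auto simp: compact_imp_closed K_def)
  \<comment> \<open>The point \<open>a + 1\<close> is left out because it has the same image as
    \<open>a\<close> but may lie outside \<open>{a..b}\<close>.\<close>
  have inK: "s \<in> {a..b}" if "?e s \<in> K" "s \<in> {a..a + 1} - {a + 1}" for s
  proof -
    obtain u where u: "u \<in> {a..b}" "?e s = ?e u"
      using \<open>?e s \<in> K\<close> by (auto simp: K_def)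
    then have "torus_of s = torus_of u" by (simp add: torus_of_eq_iff)
    then have "s - u \<in> \<int>" by transfer (simp add: int_cong_def)
    then obtain n :: int where n: "s = u + n"
      by (metis Ints_cases add.commute diff_add_cancel)
    \<comment> \<open>The value -1 occurs only for \<open>s = a\<close> and
      \<open>u = b = a + 1\<close>, where the arc is the whole circle.\<close>
    have "n = 0 \<or> n = -1"
      using that u n assms by auto
    then show ?thesis
      using that u n assms by auto
  qed
  have "((\<lambda>s. 1::real) has_integral b - a) {a..b}"
    using has_integral_const_real [of "1::real" a b] assms(1) by simp
  then have Icc: "((\<lambda>s. if s \<in> {a..b} then 1 else 0 :: real) has_integral b - a) {a..a + 1}"
    using assms(2) by (subst has_integral_restrict) auto
  have \<chi>: "(?\<chi> has_integral b - a) {a..a + 1}"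
  proof (rule has_integral_spike_finite [OF _ _ Icc])
    show "finite {a + 1}" by simp
    fix s assume "s \<in> {a..a + 1} - {a + 1}"
    then have "?e s \<in> K \<longleftrightarrow> s \<in> {a..b}"
      using inK unfolding K_def by blast
    then show "?\<chi> s = (if s \<in> {a..b} then 1 else 0)"
      by (simp only:)
  qed
  have "(\<lambda>j. integral {a..a + 1} (\<lambda>s. max 0 (1 - real j * infdist (?e s) K)))
      \<longlonglongrightarrow> integral {a..a + 1} ?\<chi>"
  proof (rule dominated_convergence(2))
    show "(\<lambda>s. max 0 (1 - real j * infdist (?e s) K)) integrable_on {a..a + 1}" for j
      by (intro integrable_continuous_real continuous_intros)
    show "(\<lambda>_. 1::real) integrable_on {a..a + 1}"
      by (rule integrable_const_ivl)
    show "norm (max 0 (1 - real j * infdist (?e s) K)) \<le> 1" for j s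
      by (simp add: infdist_nonneg)
    show "(\<lambda>j. max 0 (1 - real j * infdist (?e s) K)) \<longlonglongrightarrow> ?\<chi> s" for s
    proof (cases "?e s \<in> K")
      case True
      then show ?thesis by simp
    next
      case False
      then have d: "infdist (?e s) K > 0"
        using \<open>closed K\<close> \<open>K \<noteq> {}\<close> by (simp add: infdist_pos_not_in_closed)
      obtain j0 :: nat where j0: "1 / infdist (?e s) K < j0"
        using reals_Archimedean2 by blast
      have "\<forall>\<^sub>F j in sequentially. max 0 (1 - real j * infdist (?e s) K) = 0"
        using eventually_ge_at_top [of j0]
      proof eventually_elim
        case (elim j)
        then have "1 / infdist (?e s) K < real j" using j0 by linarith
        then show ?case using d by (simp add: divide_less_eq)
      qed
      then show ?thesis using False by (simp add: tendsto_eventually)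
    qed
  qed
  then show ?thesis
    using integral_unique [OF \<chi>] by simp
qed

lemma weyl_closed_arc:
  fixes r :: "nat \<Rightarrow> real"
  assumes weyl: "\<And>k. (\<lambda>N. (\<Sum>n=1..N. cis (2 * pi * real (Suc k) * r n)) / of_nat N) \<longlonglongrightarrow> 0"
    and ab: "a \<le> b" "b \<le> a + 1" and "e > 0"
  shows "\<forall>\<^sub>F N in sequentially.
    real (card {i \<in> {1..N}. torus_of (r i) \<in> torus_of ` {a..b}}) / real N < b - a + e"
proof -
  define K where "K = (\<lambda>s. cis (2 * pi * s)) ` {a..b}"
  define h where "h = (\<lambda>j z. max 0 (1 - real j * infdist z K))"
  have "\<forall>\<^sub>F j in sequentially. integral {a..a + 1} (\<lambda>s. h j (cis (2 * pi * s))) < b - a + e"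
    using integral_tent_tendsto [OF ab] \<open>e > 0\<close>
    unfolding h_def K_def by (intro order_tendstoD) auto
  then obtain j where j: "integral {a..a + 1} (\<lambda>s. h j (cis (2 * pi * s))) < b - a + e"
    using eventually_happens' sequentially_bot by blast
  have "continuous_on (sphere 0 1) (h j)"
    unfolding h_def by (intro continuous_intros)
  from order_tendstoD(2) [OF weyl_continuous [OF weyl this] j]
  show ?thesis
  proof eventually_elim
    case (elim N)
    have "real (card {i \<in> {1..N}. torus_of (r i) \<in> torus_of ` {a..b}})
        = (\<Sum>i=1..N. if torus_of (r i) \<in> torus_of ` {a..b} then 1 else 0)"
      by (simp add: sum.If_cases Int_def)
    also have "\<dots> \<le> (\<Sum>i=1..N. h j (cis (2 * pi * r i)))"
    proof (rule sum_mono)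
      show "(if torus_of (r i) \<in> torus_of ` {a..b} then 1 else 0) \<le> h j (cis (2 * pi * r i))" for i
      proof (cases "torus_of (r i) \<in> torus_of ` {a..b}")
        case True
        then have "cis (2 * pi * r i) \<in> K"
          by (auto simp: K_def torus_of_eq_iff)
        then show ?thesis by (simp add: h_def)
      qed (simp add: h_def)
    qed
    finally show ?case
      using elim by (meson divide_right_mono of_nat_0_le_iff order_le_less_trans)
  qed
qed

section \<open>Arcs, their complements and Weyl's criterion\<close>

text \<open>An interval containing points at distance at least 1 would contain two points differing
  by exactly 1, against injectivity. The end points are the infimum and the supremum.\<close>

lemma arc_bounds:
  fixes I :: "real set"
  assumes "is_interval I" "inj_on torus_of I" "I \<noteq> {}"
  obtains a b where "a \<le> b" "b \<le> a + 1" "{a<..<b} \<subseteq> I" "I \<subseteq> {a..b}"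
proof -
  have less: "q < p + 1" if "p \<in> I" "q \<in> I" for p q
  proof (rule ccontr)
    assume "\<not> q < p + 1"
    then have "p + 1 \<in> I"
      using mem_is_interval_1_I [OF assms(1) that, of "p + 1"] by simp
    moreover have "torus_of (p + 1) = torus_of p"
      by transfer (simp add: int_cong_def)
    ultimately have "p + 1 = p"
      using \<open>p \<in> I\<close> assms(2) by (blast dest: inj_onD)
    then show False by simp
  qed
  obtain p where "p \<in> I" using assms(3) by blast
  have bdd: "bdd_above I" "bdd_below I"
    using less [OF \<open>p \<in> I\<close>] less [OF _ \<open>p \<in> I\<close>]
    by (auto intro!: bdd_aboveI [of _ "p + 1"] bdd_belowI [of _ "p - 1"] less_imp_le simp: algebra_simps)
  show thesis
  proof
    show sub: "I \<subseteq> {Inf I..Sup I}"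
      using bdd by (auto intro: cInf_lower cSup_upper)
    then show "Inf I \<le> Sup I"
      using \<open>p \<in> I\<close> by auto
    have "q - 1 \<le> Inf I" if "q \<in> I" for q
      using less [OF _ that] assms(3) by (intro cInf_greatest) (auto simp: algebra_simps less_imp_le)
    then show "Sup I \<le> Inf I + 1"
      using assms(3) by (intro cSup_least) (auto simp: algebra_simps)
    show "{Inf I<..<Sup I} \<subseteq> I"
    proof
      fix s assume "s \<in> {Inf I<..<Sup I}"
      then obtain u v where "u \<in> I" "u < s" "v \<in> I" "s < v"
        using assms(3) bdd by (auto simp: cInf_less_iff less_cSup_iff)
      then show "s \<in> I"
        using mem_is_interval_1_I [OF assms(1), of u v s] by simp
    qed
  qed
qed

lemma complement_of_arc:
  fixes a b :: real
  assumes "b \<le> a + 1" "{a<..<b} \<subseteq> I" "torus_of s \<notin> torus_of ` I"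
  shows "torus_of s \<in> torus_of ` {b..a + 1}"
proof -
  have shift: "torus_of (s - of_int m) = torus_of s" for m
    by transfer (simp add: int_cong_def)
  \<comment> \<open>The representative of the point in the half-open period starting at
    \<open>a\<close>.\<close>
  define u where "u = s - of_int \<lfloor>s - a\<rfloor>"
  have u: "a \<le> u" "u < a + 1" "torus_of u = torus_of s" "torus_of (u + 1) = torus_of s"
    using shift [of "\<lfloor>s - a\<rfloor>"] shift [of "\<lfloor>s - a\<rfloor> - 1"] unfolding u_def
    by (simp_all add: algebra_simps) linarith+
  have "u \<notin> {a<..<b}"
    using assms(2,3) u(3) by (metis image_eqI subsetD)
  then consider "u = a" | "u \<in> {b..a + 1}"
    using u by force
  then show ?thesis
  proof cases
    \<comment> \<open>The end point \<open>a\<close> can be missing from \<open>I\<close>; its other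
      representative \<open>a + 1\<close> closes the complementary arc.\<close>
    case 1
    then have "u + 1 \<in> {b..a + 1}" using assms(1) by simp
    then show ?thesis using u(4) by (metis image_eqI)
  next
    case 2
    then show ?thesis using u(3) by (metis image_eqI)
  qed
qed

text \<open>The upper bound for the closure of the arc bounds its frequency from above; the upper
  bound for the complementary closed arc, of length \<open>a + 1 - b\<close>, bounds it from
  below.\<close>

lemma weyl_criterion:
  fixes r :: "nat \<Rightarrow> real"
  assumes weyl: "\<And>k. (\<lambda>N. (\<Sum>n=1..N. cis (2 * pi * real (Suc k) * r n)) / of_nat N) \<longlonglongrightarrow> 0"
  shows "uniformly_distributed (\<lambda>n. torus_of (r n))"
  unfolding uniformly_distributed_def
proof (intro allI impI, elim conjE)
  fix I :: "real set"
  assume I: "is_interval I" "inj_on torus_of I"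
  let ?C = "\<lambda>N J. real (card {i \<in> {1..N}. torus_of (r i) \<in> torus_of ` J})"
  show "(\<lambda>N. ?C N I / real N) \<longlonglongrightarrow> measure lborel I"
  proof (cases "I = {}")
    case True
    then show ?thesis by simp
  next
    case False
    then obtain a b where ab: "a \<le> b" "b \<le> a + 1" "{a<..<b} \<subseteq> I" "I \<subseteq> {a..b}"
      using arc_bounds I by blast
    have Im: "I \<in> sets lborel"
      using real_interval_borel_measurable [OF I(1)] by simp
    \<comment> \<open>End points carry no length: \<open>I\<close> lies between an open and a closed
      interval of length \<open>b - a\<close>.\<close>
    have "measure lborel I = b - a"
    proof (rule antisym)
      have ab_fm: "{a..b} \<in> fmeasurable lborel"
        by (rule fmeasurableI) (auto simp: emeasure_lborel_Icc_eq)
      then show "measure lborel I \<le> b - a"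
        using measure_mono_fmeasurable [OF ab(4) Im] ab(1) by simp
      have "I \<in> fmeasurable lborel"
        by (rule fmeasurableI2 [OF ab_fm ab(4) Im])
      then show "b - a \<le> measure lborel I"
        using measure_mono_fmeasurable [OF ab(3), of lborel] ab(1) by simp
    qed
    moreover have "(\<lambda>N. ?C N I / real N) \<longlonglongrightarrow> b - a"
    proof (rule LIMSEQ_I)
      fix e :: real assume "e > 0"
      \<comment> \<open>Says that the complementary arc \<open>{b..a + 1}\<close> is no longer than
        one period, as \<open>weyl_closed_arc\<close> requires.\<close>
      have ab': "a + 1 \<le> b + 1" using ab(1) by simp
      have "\<forall>\<^sub>F N in sequentially. norm (?C N I / real N - (b - a)) < e"
        using weyl_closed_arc [OF weyl ab(1,2) \<open>e > 0\<close>]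
          weyl_closed_arc [OF weyl ab(2) ab' \<open>e > 0\<close>] eventually_ge_at_top [of 1]
      proof eventually_elim
        case (elim N)
        have "?C N I \<le> ?C N {a..b}"
          using ab(4) by (intro of_nat_mono card_mono) auto
        then have 1: "?C N I / real N \<le> ?C N {a..b} / real N"
          by (intro divide_right_mono) auto
        \<comment> \<open>Every index falls in at least one of the two sets. An overlap at common
          end points is harmless for this direction of the inequality.\<close>
        have "card {1..N} \<le> card ({i \<in> {1..N}. torus_of (r i) \<in> torus_of ` I}
            \<union> {i \<in> {1..N}. torus_of (r i) \<in> torus_of ` {b..a + 1}})"
          using complement_of_arc [OF ab(2,3)] by (intro card_mono) auto
        also have "\<dots> \<le> card {i \<in> {1..N}. torus_of (r i) \<in> torus_of ` I}
            + card {i \<in> {1..N}. torus_of (r i) \<in> torus_of ` {b..a + 1}}"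
          by (rule card_Un_le)
        finally have "real N \<le> ?C N I + ?C N {b..a + 1}"
          by simp
        then have "1 \<le> ?C N I / real N + ?C N {b..a + 1} / real N"
          using elim(3) by (simp add: add_divide_distrib [symmetric])
        with 1 elim(1,2) show ?case
          unfolding real_norm_def by linarith
      qed
      then show "\<exists>N0. \<forall>N\<ge>N0. norm (?C N I / real N - (b - a)) < e"
        by (simp add: eventually_sequentially)
    qed
    ultimately show ?thesis by simp
  qed
qed

theorem corollary1:
  fixes x :: "nat \<Rightarrow> torus"
  assumes "\<exists>t :: nat \<Rightarrow> real. (\<forall>n\<ge>1. t n > 0) \<and> bounded (t ` {1..}) \<and>
    (\<lambda>N. (\<Sum>m=1..N. \<Sum>n=1..N. theta (t N) (x n - x m)) / (real N)\<^sup>2) \<longlonglongrightarrow> 1"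
  shows "uniformly_distributed x"
proof -
  obtain t :: "nat \<Rightarrow> real" where t: "\<And>n. n \<ge> 1 \<Longrightarrow> t n > 0" "bounded (t ` {1..})"
    "(\<lambda>N. (\<Sum>m=1..N. \<Sum>n=1..N. theta (t N) (x n - x m)) / (real N)\<^sup>2) \<longlonglongrightarrow> 1"
    using assms by blast
  \<comment> \<open>Arbitrary real representatives of the points; theta of a difference does not
    depend on their choice.\<close>
  define r where "r = (\<lambda>n. inv torus_of (x n))"
  have r: "x = (\<lambda>n. torus_of (r n))"
    by (simp add: r_def surj_f_inv_f surj_torus_of)
  have "(\<lambda>N. (\<Sum>m=1..N. \<Sum>n=1..N. theta_real (t N) (r n - r m)) / (real N)\<^sup>2) \<longlonglongrightarrow> 1"
    using t(3) by (simp only: r theta_torus_of)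
  from weyl_criterion [OF weyl_sums_tendsto_0 [OF t(1,2) this]] show ?thesis
    by (simp only: r)
qed

end
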